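(* Let $\mathbf{A}$ be a polycategory. Any proof (derivation) of a sequent in the free logic $\Sigma\Pi_{\mathbf{A}}$ can be transformed, using the cut-elimination rewrites (1)-(12) listed in the context, into a proof of the same sequent in which the only cuts are essential.
   Context: Logic. Let $\mathbf{A}$ be a symmetric polycategory. Formulas of $\Sigma\Pi_{\mathbf{A}}$ are the objects of $\mathbf{A}$ (atoms) and, for every finite (possibly empty) set $I$ and formulas $X_i$ ($i\in I$), the sum $\sum_{i\in I}a_i{:}X_i$ and the product $\prod_{i\in I}a_i{:}X_i$ (the $a_i$ are distinct names of the components). A sequent $\Gamma\vdash\Delta$ consists of two finite unordered families of formulas, every occurrence being labelled by a distinct channel name (Greek letter). Derivations are denoted by terms, formed as follows. - Axioms: every polymorphism $f:\Gamma\to\Delta$ of $\mathbf{A}$ between atoms is a derivation of $\Gamma\vdash\Delta$; in particular the identity $1_A$ derives $\alpha{:}A\vdash\beta{:}A$ for an atom $A$. - Cotuple: from $f_i$ deriving $\Gamma,\alpha{:}X_i\vdash\Delta$ for all $i\in I$, get $\alpha\{a_i\mapsto f_i\}_{i\in I}$ deriving $\Gamma,\alpha{:}\sum_i a_i{:}X_i\vdash\Delta$ ($I$ may be empty). - Tuple: from $f_i$ deriving $\Gamma\vdash\alpha{:}X_i,\Delta$ for all $i\in I$, get $\alpha(a_i\mapsto f_i)_{i\in I}$ deriving $\Gamma\vdash\alpha{:}\prod_i a_i{:}X_i,\Delta$ ($I$ may be empty). - Projection: from $f$ deriving $\Gamma,\alpha{:}X_k\vdash\Delta$, $k\in I$,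 get $\overleftarrow{\alpha}[a_k](f)$ deriving $\Gamma,\alpha{:}\prod_i a_i{:}X_i\vdash\Delta$. - Injection: from $f$ deriving $\Gamma\vdash\alpha{:}X_k,\Delta$, $k\in I$, get $\overrightarrow{\alpha}[a_k](f)$ deriving $\Gamma\vdash\alpha{:}\sum_i a_i{:}X_i,\Delta$. - Cut: from $f$ deriving $\Gamma\vdash\Delta,\gamma{:}Z$ and $g$ deriving $\gamma{:}Z,\Gamma'\vdash\Delta'$ (with $\gamma$ the only common channel name), get $f;_\gamma g$ deriving $\Gamma,\Gamma'\vdash\Delta,\Delta'$. A cut between two axioms (between atomic sequents, on an atom) is called essential; it is interpreted by the composition (cut) of $\mathbf{A}$, so its conclusion is again an axiom. Cut-elimination rewrites (applicable to subderivations; channels carrying different Greek letters are distinct; in (1),(2) up to renaming of the channel): (1) $f;_\gamma 1\Rightarrow f$; (2) $1;_\gamma f\Rightarrow f$ (identities on atoms); (3) $\alpha\{a_i\mapsto f_i\}_i;_\gamma g\Rightarrow\alpha\{a_i\mapsto f_i;_\gamma g\}_i$; (4) $f;_\gamma\beta(b_i\mapsto g_i)_i\Rightarrow\beta(b_i\mapsto f;_\gamma g_i)_i$; (5) $\overrightarrow{\alpha}[a_k](f);_\gamma g\Rightarrow\overrightarrow{\alpha}[a_k](f;_\gamma g)$; (6) $f;_\gamma\overleftarrow{\beta}[b_k](g)\Rightarrow\overleftarrow{\beta}[b_k](f;_\gamma g)$; (7) $\overleftarrow{\alpha}[a_k](f);_\gamma g\Rightarrow\overleftarrow{\alpha}[a_k](f;_\gamma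 g)$; (8) $f;_\gamma\overrightarrow{\beta}[b_k](g)\Rightarrow\overrightarrow{\beta}[b_k](f;_\gamma g)$; (9) $\alpha(a_i\mapsto f_i)_i;_\gamma g\Rightarrow\alpha(a_i\mapsto f_i;_\gamma g)_i$; (10) $f;_\gamma\beta\{b_i\mapsto g_i\}_i\Rightarrow\beta\{b_i\mapsto f;_\gamma g_i\}_i$; (11) $\overrightarrow{\gamma}[a_k](f);_\gamma\gamma\{a_i\mapsto g_i\}_i\Rightarrow f;_\gamma g_k$; (12) $\gamma(a_i\mapsto f_i)_i;_\gamma\overleftarrow{\gamma}[a_k](g)\Rightarrow f_k;_\gamma g$. *)

theory Defs
  imports Main "HOL-Library.Finite_Map" "HOL-Combinatorics.Transposition"
begin

text \<open>
  Symmetric polycategories, presented without an ordering of inputs and outputs: the source and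
  the target of a polymorphism are finite families of objects indexed by channel names, all
  channel names of a polymorphism being distinct.  The symmetric group actions of the presentation
  with lists of objects become the action \<open>relabel\<close> of the bijective renamings of channels,
  and composition \<open>polycomp A \<gamma> f g\<close> is along the channel \<open>\<gamma>\<close> shared by \<open>f\<close> and \<open>g\<close>.
\<close>

record ('c, 'o, 'm) polycat =
  Obj :: "'o set"
  Mor :: "'m set"
  src :: "'m \<Rightarrow> ('c, 'o) fmap"
  tgt :: "'m \<Rightarrow> ('c, 'o) fmap"
  ident :: "'o \<Rightarrow> 'c \<Rightarrow> 'c \<Rightarrow> 'm"
  polycomp :: "'c \<Rightarrow> 'm \<Rightarrow> 'm \<Rightarrow> 'm"
  relabel :: "('c \<Rightarrow> 'c) \<Rightarrow> 'm \<Rightarrow> 'm"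

definition chans :: "('c, 'o, 'm) polycat \<Rightarrow> 'm \<Rightarrow> 'c set" where
  "chans A f = fmdom' (src A f) \<union> fmdom' (tgt A f)"

definition composable :: "('c, 'o, 'm) polycat \<Rightarrow> 'c \<Rightarrow> 'm \<Rightarrow> 'm \<Rightarrow> bool" where
  "composable A \<gamma> f g \<longleftrightarrow> f \<in> Mor A \<and> g \<in> Mor A \<and>
     (\<exists>X. fmlookup (tgt A f) \<gamma> = Some X \<and> fmlookup (src A g) \<gamma> = Some X) \<and>
     chans A f \<inter> chans A g = {\<gamma>}"

locale polycategory =
  fixes A :: "('c, 'o, 'm) polycat"
  \<comment> \<open>Enough channels to label polymorphisms with arbitrarily many inputs and outputs.\<close>
  assumes infinite_channels: "infinite (UNIV :: 'c set)"
  assumes mor_objects: "f \<in> Mor A \<Longrightarrow> fmran' (src A f) \<union> fmran' (tgt A f) \<subseteq> Obj A"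
    and mor_disjoint: "f \<in> Mor A \<Longrightarrow> fmdom' (src A f) \<inter> fmdom' (tgt A f) = {}"
  assumes relabel_mor: "f \<in> Mor A \<Longrightarrow> bij \<pi> \<Longrightarrow> relabel A \<pi> f \<in> Mor A"
    and relabel_src: "f \<in> Mor A \<Longrightarrow> bij \<pi> \<Longrightarrow>
          fmlookup (src A (relabel A \<pi> f)) (\<pi> \<alpha>) = fmlookup (src A f) \<alpha>"
    and relabel_tgt: "f \<in> Mor A \<Longrightarrow> bij \<pi> \<Longrightarrow>
          fmlookup (tgt A (relabel A \<pi> f)) (\<pi> \<alpha>) = fmlookup (tgt A f) \<alpha>"
    and relabel_comp: "f \<in> Mor A \<Longrightarrow> bij \<pi> \<Longrightarrow> bij \<rho> \<Longrightarrow>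
          relabel A (\<pi> \<circ> \<rho>) f = relabel A \<pi> (relabel A \<rho> f)"
    and relabel_fix: "f \<in> Mor A \<Longrightarrow> bij \<pi> \<Longrightarrow> (\<And>\<alpha>. \<alpha> \<in> chans A f \<Longrightarrow> \<pi> \<alpha> = \<alpha>) \<Longrightarrow>
          relabel A \<pi> f = f"
  assumes ident_mor: "X \<in> Obj A \<Longrightarrow> \<alpha> \<noteq> \<beta> \<Longrightarrow> ident A X \<alpha> \<beta> \<in> Mor A"
    and ident_src: "X \<in> Obj A \<Longrightarrow> \<alpha> \<noteq> \<beta> \<Longrightarrow> src A (ident A X \<alpha> \<beta>) = fmupd \<alpha> X fmempty"
    and ident_tgt: "X \<in> Obj A \<Longrightarrow> \<alpha> \<noteq> \<beta> \<Longrightarrow> tgt A (ident A X \<alpha> \<beta>) = fmupd \<beta> X fmempty"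
    and relabel_ident: "X \<in> Obj A \<Longrightarrow> \<alpha> \<noteq> \<beta> \<Longrightarrow> bij \<pi> \<Longrightarrow>
          relabel A \<pi> (ident A X \<alpha> \<beta>) = ident A X (\<pi> \<alpha>) (\<pi> \<beta>)"
  assumes comp_mor: "composable A \<gamma> f g \<Longrightarrow> polycomp A \<gamma> f g \<in> Mor A"
    and comp_src: "composable A \<gamma> f g \<Longrightarrow>
          src A (polycomp A \<gamma> f g) = src A f ++\<^sub>f fmdrop \<gamma> (src A g)"
    and comp_tgt: "composable A \<gamma> f g \<Longrightarrow>
          tgt A (polycomp A \<gamma> f g) = fmdrop \<gamma> (tgt A f) ++\<^sub>f tgt A g"
    and relabel_comp_mor: "composable A \<gamma> f g \<Longrightarrow> bij \<pi> \<Longrightarrow>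
          relabel A \<pi> (polycomp A \<gamma> f g) = polycomp A (\<pi> \<gamma>) (relabel A \<pi> f) (relabel A \<pi> g)"
  assumes comp_ident_right: "X \<in> Obj A \<Longrightarrow> \<beta> \<noteq> \<gamma> \<Longrightarrow> composable A \<gamma> f (ident A X \<gamma> \<beta>) \<Longrightarrow>
          polycomp A \<gamma> f (ident A X \<gamma> \<beta>) = relabel A (transpose \<gamma> \<beta>) f"
    and comp_ident_left: "X \<in> Obj A \<Longrightarrow> \<beta> \<noteq> \<gamma> \<Longrightarrow> composable A \<gamma> (ident A X \<beta> \<gamma>) f \<Longrightarrow>
          polycomp A \<gamma> (ident A X \<beta> \<gamma>) f = relabel A (transpose \<gamma> \<beta>) f"
    and comp_assoc: "composable A \<gamma> f g \<Longrightarrow> composable A \<delta> g h \<Longrightarrow> chans A f \<inter> chans A h = {} \<Longrightarrow>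
          polycomp A \<delta> (polycomp A \<gamma> f g) h = polycomp A \<gamma> f (polycomp A \<delta> g h)"
    and comp_interchange_tgt:
      "composable A \<gamma> f g \<Longrightarrow> composable A \<delta> f h \<Longrightarrow> chans A g \<inter> chans A h = {} \<Longrightarrow>
          polycomp A \<delta> (polycomp A \<gamma> f g) h = polycomp A \<gamma> (polycomp A \<delta> f h) g"
    and comp_interchange_src:
      "composable A \<gamma> f h \<Longrightarrow> composable A \<delta> g h \<Longrightarrow> chans A f \<inter> chans A g = {} \<Longrightarrow>
          polycomp A \<gamma> f (polycomp A \<delta> g h) = polycomp A \<delta> g (polycomp A \<gamma> f h)"

text \<open>
  The index set of a sum or product is the finite set of its component names, so that an indexed
  family is a finite map on names; likewise for the premises of cotuples and tuples below.
\<close>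

datatype ('n, atoms: 'o) formula =
  Atom 'o
| Sum "('n, ('n, 'o) formula) fmap"
| Prod "('n, ('n, 'o) formula) fmap"

type_synonym ('c, 'n, 'o) family = "('c, ('n, 'o) formula) fmap"

definition sequent ::
  "('c, 'o, 'm) polycat \<Rightarrow> ('c, 'n, 'o) family \<Rightarrow> ('c, 'n, 'o) family \<Rightarrow> bool" where
  "sequent A \<Gamma> \<Delta> \<longleftrightarrow> fmdom' \<Gamma> \<inter> fmdom' \<Delta> = {} \<and>
     (\<forall>X \<in> fmran' \<Gamma> \<union> fmran' \<Delta>. atoms X \<subseteq> Obj A)"

datatype ('c, 'n, 'm) deriv =
  Ax 'm
| Cotuple 'c "('n, ('c, 'n, 'm) deriv) fmap"
| Tuple 'c "('n, ('c, 'n, 'm) deriv) fmap"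
| Proj 'c 'n "('c, 'n, 'm) deriv"
| Inj 'c 'n "('c, 'n, 'm) deriv"
| Cut "('c, 'n, 'm) deriv" 'c "('c, 'n, 'm) deriv"

inductive derives ::
  "('c, 'o, 'm) polycat \<Rightarrow> ('c, 'n, 'm) deriv \<Rightarrow> ('c, 'n, 'o) family \<Rightarrow> ('c, 'n, 'o) family \<Rightarrow> bool"
  for A where
  Ax: "f \<in> Mor A \<Longrightarrow> derives A (Ax f) (fmmap Atom (src A f)) (fmmap Atom (tgt A f))"
| Cotuple: "\<alpha> |\<notin>| fmdom \<Gamma> \<Longrightarrow> sequent A (fmupd \<alpha> (Sum Xs) \<Gamma>) \<Delta> \<Longrightarrow>
    fmrel (\<lambda>X f. derives A f (fmupd \<alpha> X \<Gamma>) \<Delta>) Xs fs \<Longrightarrow>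
    derives A (Cotuple \<alpha> fs) (fmupd \<alpha> (Sum Xs) \<Gamma>) \<Delta>"
| Tuple: "\<alpha> |\<notin>| fmdom \<Delta> \<Longrightarrow> sequent A \<Gamma> (fmupd \<alpha> (Prod Xs) \<Delta>) \<Longrightarrow>
    fmrel (\<lambda>X f. derives A f \<Gamma> (fmupd \<alpha> X \<Delta>)) Xs fs \<Longrightarrow>
    derives A (Tuple \<alpha> fs) \<Gamma> (fmupd \<alpha> (Prod Xs) \<Delta>)"
| Proj: "\<alpha> |\<notin>| fmdom \<Gamma> \<Longrightarrow> sequent A (fmupd \<alpha> (Prod Xs) \<Gamma>) \<Delta> \<Longrightarrow>
    fmlookup Xs k = Some X \<Longrightarrow> derives A f (fmupd \<alpha> X \<Gamma>) \<Delta> \<Longrightarrow>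
    derives A (Proj \<alpha> k f) (fmupd \<alpha> (Prod Xs) \<Gamma>) \<Delta>"
| Inj: "\<alpha> |\<notin>| fmdom \<Delta> \<Longrightarrow> sequent A \<Gamma> (fmupd \<alpha> (Sum Xs) \<Delta>) \<Longrightarrow>
    fmlookup Xs k = Some X \<Longrightarrow> derives A f \<Gamma> (fmupd \<alpha> X \<Delta>) \<Longrightarrow>
    derives A (Inj \<alpha> k f) \<Gamma> (fmupd \<alpha> (Sum Xs) \<Delta>)"
| Cut: "\<gamma> |\<notin>| fmdom \<Delta> \<Longrightarrow> \<gamma> |\<notin>| fmdom \<Gamma>' \<Longrightarrow>
    (fmdom' \<Gamma> \<union> fmdom' (fmupd \<gamma> Z \<Delta>)) \<inter> (fmdom' (fmupd \<gamma> Z \<Gamma>') \<union> fmdom' \<Delta>') = {\<gamma>} \<Longrightarrow>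
    derives A f \<Gamma> (fmupd \<gamma> Z \<Delta>) \<Longrightarrow> derives A g (fmupd \<gamma> Z \<Gamma>') \<Delta>' \<Longrightarrow>
    derives A (Cut f \<gamma> g) (\<Gamma> ++\<^sub>f \<Gamma>') (\<Delta> ++\<^sub>f \<Delta>')"
monos fmap.rel_mono_strong

text \<open>
  Renaming acts on all channels, including those consumed by inner cuts, so renaming along a
  transposition with a channel that does not occur in the conclusion cannot capture a channel.
\<close>

primrec rename :: "('c, 'o, 'm) polycat \<Rightarrow> ('c \<Rightarrow> 'c) \<Rightarrow> ('c, 'n, 'm) deriv \<Rightarrow> ('c, 'n, 'm) deriv"
  where
  "rename A \<pi> (Ax f) = Ax (relabel A \<pi> f)"
| "rename A \<pi> (Cotuple \<alpha> fs) = Cotuple (\<pi> \<alpha>) (fmmap (rename A \<pi>) fs)"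
| "rename A \<pi> (Tuple \<alpha> fs) = Tuple (\<pi> \<alpha>) (fmmap (rename A \<pi>) fs)"
| "rename A \<pi> (Proj \<alpha> k f) = Proj (\<pi> \<alpha>) k (rename A \<pi> f)"
| "rename A \<pi> (Inj \<alpha> k f) = Inj (\<pi> \<alpha>) k (rename A \<pi> f)"
| "rename A \<pi> (Cut f \<gamma> g) = Cut (rename A \<pi> f) (\<pi> \<gamma>) (rename A \<pi> g)"

inductive rewrite ::
  "('c, 'o, 'm) polycat \<Rightarrow> ('c, 'n, 'm) deriv \<Rightarrow> ('c, 'n, 'm) deriv \<Rightarrow> bool"
  for A where
  r1: "X \<in> Obj A \<Longrightarrow> \<beta> \<noteq> \<gamma> \<Longrightarrow>
    rewrite A (Cut f \<gamma> (Ax (ident A X \<gamma> \<beta>))) (rename A (transpose \<gamma> \<beta>) f)"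
| r2: "X \<in> Obj A \<Longrightarrow> \<beta> \<noteq> \<gamma> \<Longrightarrow>
    rewrite A (Cut (Ax (ident A X \<beta> \<gamma>)) \<gamma> f) (rename A (transpose \<gamma> \<beta>) f)"
| r3: "\<alpha> \<noteq> \<gamma> \<Longrightarrow>
    rewrite A (Cut (Cotuple \<alpha> fs) \<gamma> g) (Cotuple \<alpha> (fmmap (\<lambda>f. Cut f \<gamma> g) fs))"
| r4: "\<beta> \<noteq> \<gamma> \<Longrightarrow>
    rewrite A (Cut f \<gamma> (Tuple \<beta> gs)) (Tuple \<beta> (fmmap (\<lambda>g. Cut f \<gamma> g) gs))"
| r5: "\<alpha> \<noteq> \<gamma> \<Longrightarrow> rewrite A (Cut (Inj \<alpha> k f) \<gamma> g) (Inj \<alpha> k (Cut f \<gamma> g))"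
| r6: "\<beta> \<noteq> \<gamma> \<Longrightarrow> rewrite A (Cut f \<gamma> (Proj \<beta> k g)) (Proj \<beta> k (Cut f \<gamma> g))"
| r7: "\<alpha> \<noteq> \<gamma> \<Longrightarrow> rewrite A (Cut (Proj \<alpha> k f) \<gamma> g) (Proj \<alpha> k (Cut f \<gamma> g))"
| r8: "\<beta> \<noteq> \<gamma> \<Longrightarrow> rewrite A (Cut f \<gamma> (Inj \<beta> k g)) (Inj \<beta> k (Cut f \<gamma> g))"
| r9: "\<alpha> \<noteq> \<gamma> \<Longrightarrow>
    rewrite A (Cut (Tuple \<alpha> fs) \<gamma> g) (Tuple \<alpha> (fmmap (\<lambda>f. Cut f \<gamma> g) fs))"
| r10: "\<beta> \<noteq> \<gamma> \<Longrightarrow>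
    rewrite A (Cut f \<gamma> (Cotuple \<beta> gs)) (Cotuple \<beta> (fmmap (\<lambda>g. Cut f \<gamma> g) gs))"
| r11: "fmlookup gs k = Some g \<Longrightarrow> rewrite A (Cut (Inj \<gamma> k f) \<gamma> (Cotuple \<gamma> gs)) (Cut f \<gamma> g)"
| r12: "fmlookup fs k = Some f \<Longrightarrow> rewrite A (Cut (Tuple \<gamma> fs) \<gamma> (Proj \<gamma> k g)) (Cut f \<gamma> g)"
| in_Cotuple: "fmlookup fs k = Some f \<Longrightarrow> rewrite A f f' \<Longrightarrow>
    rewrite A (Cotuple \<alpha> fs) (Cotuple \<alpha> (fmupd k f' fs))"
| in_Tuple: "fmlookup fs k = Some f \<Longrightarrow> rewrite A f f' \<Longrightarrow>
    rewrite A (Tuple \<alpha> fs) (Tuple \<alpha> (fmupd k f' fs))"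
| in_Proj: "rewrite A f f' \<Longrightarrow> rewrite A (Proj \<alpha> k f) (Proj \<alpha> k f')"
| in_Inj: "rewrite A f f' \<Longrightarrow> rewrite A (Inj \<alpha> k f) (Inj \<alpha> k f')"
| in_Cut_left: "rewrite A f f' \<Longrightarrow> rewrite A (Cut f \<gamma> g) (Cut f' \<gamma> g)"
| in_Cut_right: "rewrite A g g' \<Longrightarrow> rewrite A (Cut f \<gamma> g) (Cut f \<gamma> g')"

text \<open>
  A cut of two axioms is interpreted by composition and so counts as an axiom again, in
  particular as a premise of further essential cuts.  \<open>axiom_of A d f\<close> says that the derivation
  \<open>d\<close> is in this sense the axiom \<open>f\<close>; by the lemma below, its conclusion is then the atomic
  sequent of \<open>f\<close>.
\<close>

inductive axiom_of :: "('c, 'o, 'm) polycat \<Rightarrow> ('c, 'n, 'm) deriv \<Rightarrow> 'm \<Rightarrow> bool"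
  for A where
  "axiom_of A (Ax f) f"
| "axiom_of A d f \<Longrightarrow> axiom_of A e g \<Longrightarrow> axiom_of A (Cut d \<gamma> e) (polycomp A \<gamma> f g)"

lemma axiom_of_derives:
  assumes "polycategory A" and "axiom_of A d f" and "derives A d \<Gamma> \<Delta>"
  shows "f \<in> Mor A \<and> \<Gamma> = fmmap Atom (src A f) \<and> \<Delta> = fmmap Atom (tgt A f)"
  using assms(2,3)
proof (induction arbitrary: \<Gamma> \<Delta> rule: axiom_of.induct)
  case (1 f)
  then show ?case by (cases rule: derives.cases) auto
next
  case (2 d f e g \<gamma>)
  from "2.prems" obtain \<Gamma>1 \<Delta>1 \<Gamma>2 \<Delta>2 Z where
    eq: "\<Gamma> = \<Gamma>1 ++\<^sub>f \<Gamma>2" "\<Delta> = \<Delta>1 ++\<^sub>f \<Delta>2" and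
    fresh: "\<gamma> |\<notin>| fmdom \<Delta>1" "\<gamma> |\<notin>| fmdom \<Gamma>2" and
    disj: "(fmdom' \<Gamma>1 \<union> fmdom' (fmupd \<gamma> Z \<Delta>1)) \<inter> (fmdom' (fmupd \<gamma> Z \<Gamma>2) \<union> fmdom' \<Delta>2) = {\<gamma>}" and
    d: "derives A d \<Gamma>1 (fmupd \<gamma> Z \<Delta>1)" and e: "derives A e (fmupd \<gamma> Z \<Gamma>2) \<Delta>2"
    by (cases rule: derives.cases) auto
  have f: "f \<in> Mor A" "\<Gamma>1 = fmmap Atom (src A f)" "fmupd \<gamma> Z \<Delta>1 = fmmap Atom (tgt A f)"
    using "2.IH"(1)[OF d] by auto
  have g: "g \<in> Mor A" "fmupd \<gamma> Z \<Gamma>2 = fmmap Atom (src A g)" "\<Delta>2 = fmmap Atom (tgt A g)"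
    using "2.IH"(2)[OF e] by auto
  have "fmlookup (fmmap Atom (tgt A f)) \<gamma> = Some Z" "fmlookup (fmmap Atom (src A g)) \<gamma> = Some Z"
    unfolding f(3)[symmetric] g(2)[symmetric] by auto
  then have Z: "\<exists>X. fmlookup (tgt A f) \<gamma> = Some X \<and> fmlookup (src A g) \<gamma> = Some X" by auto
  have "chans A f \<inter> chans A g = {\<gamma>}"
    using disj unfolding f(3) g(2) unfolding f g by (simp add: chans_def)
  then have c: "composable A \<gamma> f g" using f(1) g(1) Z by (simp add: composable_def)
  have "\<Delta>1 = fmdrop \<gamma> (fmmap Atom (tgt A f))" "\<Gamma>2 = fmdrop \<gamma> (fmmap Atom (src A g))"
    unfolding f(3)[symmetric] g(2)[symmetric] using fresh
    by (auto intro!: fmap_ext simp: fmdom_notD)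
  then show ?case
    using c f(2) g(3) eq polycategory.comp_mor[OF assms(1) c] polycategory.comp_src[OF assms(1) c]
      polycategory.comp_tgt[OF assms(1) c] by simp
qed

definition essential_cut ::
  "('c, 'o, 'm) polycat \<Rightarrow> ('c, 'n, 'm) deriv \<Rightarrow> ('c, 'n, 'm) deriv \<Rightarrow> bool" where
  "essential_cut A d e \<longleftrightarrow> (\<exists>f. axiom_of A d f) \<and> (\<exists>g. axiom_of A e g)"

inductive only_essential_cuts :: "('c, 'o, 'm) polycat \<Rightarrow> ('c, 'n, 'm) deriv \<Rightarrow> bool"
  for A where
  "only_essential_cuts A (Ax f)"
| "(\<And>f. f \<in> fmran' fs \<Longrightarrow> only_essential_cuts A f) \<Longrightarrow> only_essential_cuts A (Cotuple \<alpha> fs)"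
| "(\<And>f. f \<in> fmran' fs \<Longrightarrow> only_essential_cuts A f) \<Longrightarrow> only_essential_cuts A (Tuple \<alpha> fs)"
| "only_essential_cuts A f \<Longrightarrow> only_essential_cuts A (Proj \<alpha> k f)"
| "only_essential_cuts A f \<Longrightarrow> only_essential_cuts A (Inj \<alpha> k f)"
| "essential_cut A f g \<Longrightarrow> only_essential_cuts A f \<Longrightarrow> only_essential_cuts A g \<Longrightarrow>
    only_essential_cuts A (Cut f \<gamma> g)"

end

theory Submission imports Defs begin

text \<open>
  Cuts are eliminated innermost first.  If the premises \<open>f\<close> and \<open>g\<close> of a cut contain only
  essential cuts, then every applicable rewrite (3)-(12) replaces the cut by cuts in which one of
  \<open>f\<close>, \<open>g\<close> is replaced by an immediate subderivation and the other one does not grow; all rules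
  being additive, nothing else is needed for termination.  If neither premise can be decomposed,
  both are axioms, because a formula introduced by a logical rule is not atomic.  The identity
  rewrites (1) and (2) are never used.
\<close>

lemma fmupd_fmdrop: "fmupd k v (fmdrop k m) = fmupd k v m"
  by (rule fmap_ext) auto

lemma fmupd_idem: "fmlookup m k = Some v \<Longrightarrow> fmupd k v m = m"
  by (rule fmap_ext) auto

section \<open>Derivability in terms of lookups\<close>

text \<open>The rules of \<open>derives\<close> split the principal formula off a context lacking
  its channel. Taking \<open>fmdrop \<alpha> \<Gamma>\<close> for that context turns the rule into
  one about a family in which the formula is looked up, which also fits the merged families of a
  cut.\<close>

lemma derives_CotupleI:
  assumes "fmlookup \<Gamma> \<alpha> = Some (Sum Xs)" "sequent A \<Gamma> \<Delta>"
    and "fmrel (\<lambda>X f. derives A f (fmupd \<alpha> X \<Gamma>) \<Delta>) Xs fs"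
  shows "derives A (Cotuple \<alpha> fs) \<Gamma> \<Delta>"
  using derives.Cotuple[of \<alpha> "fmdrop \<alpha> \<Gamma>" A Xs \<Delta> fs] assms
  by (simp add: fmupd_fmdrop fmupd_idem)

lemma derives_TupleI:
  assumes "fmlookup \<Delta> \<alpha> = Some (Prod Xs)" "sequent A \<Gamma> \<Delta>"
    and "fmrel (\<lambda>X f. derives A f \<Gamma> (fmupd \<alpha> X \<Delta>)) Xs fs"
  shows "derives A (Tuple \<alpha> fs) \<Gamma> \<Delta>"
  using derives.Tuple[of \<alpha> "fmdrop \<alpha> \<Delta>" A \<Gamma> Xs fs] assms
  by (simp add: fmupd_fmdrop fmupd_idem)

lemma derives_ProjI:
  assumes "fmlookup \<Gamma> \<alpha> = Some (Prod Xs)" "sequent A \<Gamma> \<Delta>" "fmlookup Xs k = Some X"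
    and "derives A f (fmupd \<alpha> X \<Gamma>) \<Delta>"
  shows "derives A (Proj \<alpha> k f) \<Gamma> \<Delta>"
  using derives.Proj[of \<alpha> "fmdrop \<alpha> \<Gamma>" A Xs \<Delta> k X f] assms
  by (simp add: fmupd_fmdrop fmupd_idem)

lemma derives_InjI:
  assumes "fmlookup \<Delta> \<alpha> = Some (Sum Xs)" "sequent A \<Gamma> \<Delta>" "fmlookup Xs k = Some X"
    and "derives A f \<Gamma> (fmupd \<alpha> X \<Delta>)"
  shows "derives A (Inj \<alpha> k f) \<Gamma> \<Delta>"
  using derives.Inj[of \<alpha> "fmdrop \<alpha> \<Delta>" A \<Gamma> Xs k X f] assms
  by (simp add: fmupd_fmdrop fmupd_idem)

lemma derives_CotupleE:
  assumes "derives A (Cotuple \<alpha> fs) \<Gamma> \<Delta>"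
  obtains Xs where "fmlookup \<Gamma> \<alpha> = Some (Sum Xs)" "sequent A \<Gamma> \<Delta>"
    "fmrel (\<lambda>X f. derives A f (fmupd \<alpha> X \<Gamma>) \<Delta>) Xs fs"
  using assms by (cases rule: derives.cases) auto

lemma derives_TupleE:
  assumes "derives A (Tuple \<alpha> fs) \<Gamma> \<Delta>"
  obtains Xs where "fmlookup \<Delta> \<alpha> = Some (Prod Xs)" "sequent A \<Gamma> \<Delta>"
    "fmrel (\<lambda>X f. derives A f \<Gamma> (fmupd \<alpha> X \<Delta>)) Xs fs"
  using assms by (cases rule: derives.cases) auto

lemma derives_ProjE:
  assumes "derives A (Proj \<alpha> k f) \<Gamma> \<Delta>"
  obtains Xs X where "fmlookup \<Gamma> \<alpha> = Some (Prod Xs)" "sequent A \<Gamma> \<Delta>"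
    "fmlookup Xs k = Some X" "derives A f (fmupd \<alpha> X \<Gamma>) \<Delta>"
  using assms by (cases rule: derives.cases) auto

lemma derives_InjE:
  assumes "derives A (Inj \<alpha> k f) \<Gamma> \<Delta>"
  obtains Xs X where "fmlookup \<Delta> \<alpha> = Some (Sum Xs)" "sequent A \<Gamma> \<Delta>"
    "fmlookup Xs k = Some X" "derives A f \<Gamma> (fmupd \<alpha> X \<Delta>)"
  using assms by (cases rule: derives.cases) auto

section \<open>Sequents that can be cut along a channel\<close>

definition channels :: "('c, 'n, 'o) family \<Rightarrow> ('c, 'n, 'o) family \<Rightarrow> 'c set" where
  "channels \<Gamma> \<Delta> = fmdom' \<Gamma> \<union> fmdom' \<Delta>"

text \<open>The side conditions of the cut rule, expressed on the full premise sequents with the cut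
  formula still present, so that changes of a premise can be compared directly.\<close>

definition cuttable :: "'c \<Rightarrow> ('c, 'n, 'o) family \<Rightarrow> ('c, 'n, 'o) family \<Rightarrow>
    ('c, 'n, 'o) family \<Rightarrow> ('c, 'n, 'o) family \<Rightarrow> bool" where
  "cuttable \<gamma> \<Gamma>1 \<Delta>1 \<Gamma>2 \<Delta>2 \<longleftrightarrow>
     (\<exists>Z. fmlookup \<Delta>1 \<gamma> = Some Z \<and> fmlookup \<Gamma>2 \<gamma> = Some Z) \<and>
     channels \<Gamma>1 \<Delta>1 \<inter> channels \<Gamma>2 \<Delta>2 = {\<gamma>}"

lemma derives_CutI:
  assumes "cuttable \<gamma> \<Gamma>1 \<Delta>1 \<Gamma>2 \<Delta>2" "derives A f \<Gamma>1 \<Delta>1" "derives A g \<Gamma>2 \<Delta>2"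
  shows "derives A (Cut f \<gamma> g) (\<Gamma>1 ++\<^sub>f fmdrop \<gamma> \<Gamma>2) (fmdrop \<gamma> \<Delta>1 ++\<^sub>f \<Delta>2)"
proof -
  from assms(1) obtain Z where Z: "fmlookup \<Delta>1 \<gamma> = Some Z" "fmlookup \<Gamma>2 \<gamma> = Some Z"
    and "channels \<Gamma>1 \<Delta>1 \<inter> channels \<Gamma>2 \<Delta>2 = {\<gamma>}" by (auto simp: cuttable_def)
  then show ?thesis
    using derives.Cut[of \<gamma> "fmdrop \<gamma> \<Delta>1" "fmdrop \<gamma> \<Gamma>2" \<Gamma>1 Z \<Delta>2 A f g] assms(2,3)
    by (simp only: fmupd_fmdrop fmupd_idem channels_def) simp
qed

text \<open>Translates the cut rule of \<open>derives\<close> into this form: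
  \<open>\<gamma>\<close> is fresh for both side contexts, so dropping it undoes the update
  exactly.\<close>

lemma cuttable_fmupd:
  assumes "\<gamma> |\<notin>| fmdom \<Delta>" "\<gamma> |\<notin>| fmdom \<Gamma>'"
    and "(fmdom' \<Gamma> \<union> fmdom' (fmupd \<gamma> Z \<Delta>)) \<inter> (fmdom' (fmupd \<gamma> Z \<Gamma>') \<union> fmdom' \<Delta>') = {\<gamma>}"
  shows "cuttable \<gamma> \<Gamma> (fmupd \<gamma> Z \<Delta>) (fmupd \<gamma> Z \<Gamma>') \<Delta>'"
    and "\<Gamma> ++\<^sub>f \<Gamma>' = \<Gamma> ++\<^sub>f fmdrop \<gamma> (fmupd \<gamma> Z \<Gamma>')"
    and "\<Delta> ++\<^sub>f \<Delta>' = fmdrop \<gamma> (fmupd \<gamma> Z \<Delta>) ++\<^sub>f \<Delta>'"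
proof -
  have "fmdrop \<gamma> (fmupd \<gamma> Z \<Delta>) = \<Delta>" "fmdrop \<gamma> (fmupd \<gamma> Z \<Gamma>') = \<Gamma>'"
    using assms(1,2) by (auto intro!: fmap_ext simp: fmdom_notD)
  then show "\<Gamma> ++\<^sub>f \<Gamma>' = \<Gamma> ++\<^sub>f fmdrop \<gamma> (fmupd \<gamma> Z \<Gamma>')"
    "\<Delta> ++\<^sub>f \<Delta>' = fmdrop \<gamma> (fmupd \<gamma> Z \<Delta>) ++\<^sub>f \<Delta>'" by simp_all
qed (use assms in \<open>auto simp: cuttable_def channels_def\<close>)

text \<open>The premises share only \<open>\<gamma>\<close>. As it occurs in \<Delta>1 and
  \<Gamma>2, it is absent from \<Gamma>1 and \<Delta>2, and the two \<open>fmdrop\<close>s remove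
  its remaining occurrences. Merging families adds no new formulas.\<close>

lemma sequent_cut:
  assumes c: "cuttable \<gamma> \<Gamma>1 \<Delta>1 \<Gamma>2 \<Delta>2" and s: "sequent A \<Gamma>1 \<Delta>1" "sequent A \<Gamma>2 \<Delta>2"
  shows "sequent A (\<Gamma>1 ++\<^sub>f fmdrop \<gamma> \<Gamma>2) (fmdrop \<gamma> \<Delta>1 ++\<^sub>f \<Delta>2)"
proof -
  have "\<gamma> \<in> fmdom' \<Delta>1" "\<gamma> \<in> fmdom' \<Gamma>2" using c by (auto simp: cuttable_def fmdom'I)
  then have "fmdom' (\<Gamma>1 ++\<^sub>f fmdrop \<gamma> \<Gamma>2) \<inter> fmdom' (fmdrop \<gamma> \<Delta>1 ++\<^sub>f \<Delta>2) = {}"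
    using c s unfolding cuttable_def sequent_def channels_def by simp blast
  moreover have "fmran' (\<Gamma>1 ++\<^sub>f fmdrop \<gamma> \<Gamma>2) \<subseteq> fmran' \<Gamma>1 \<union> fmran' \<Gamma>2"
    "fmran' (fmdrop \<gamma> \<Delta>1 ++\<^sub>f \<Delta>2) \<subseteq> fmran' \<Delta>1 \<union> fmran' \<Delta>2"
    by (auto simp: fmlookup_ran'_iff split: if_splits)
  ultimately show ?thesis using s unfolding sequent_def by blast
qed

text \<open>The logical rules carry well-formedness of their conclusion as a premise, so the work
  lies in axioms, where it comes from the polycategory, and in cuts.\<close>

lemma derives_sequent:
  assumes "polycategory A" and "derives A d \<Gamma> \<Delta>"
  shows "sequent A \<Gamma> \<Delta>"
  using assms(2)
proof (induction rule: derives.induct)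
  case (Ax f)
  then show ?case
    using polycategory.mor_objects[OF assms(1) Ax] polycategory.mor_disjoint[OF assms(1) Ax]
    by (auto simp: sequent_def fmlookup_ran'_iff)
next
  case (Cut \<gamma> \<Delta> \<Gamma>' \<Gamma> Z \<Delta>' f g)
  then show ?case
    unfolding cuttable_fmupd(2)[OF Cut(1-3)] cuttable_fmupd(3)[OF Cut(1-3)]
    by (intro sequent_cut cuttable_fmupd)
qed auto

section \<open>Normalizable derivations\<close>

text \<open>Derivability of the result is part of the property, so that preservation of the sequent
  is established along the reduction being constructed.\<close>

definition normalizable ::
  "('c, 'o, 'm) polycat \<Rightarrow> ('c, 'n, 'm) deriv \<Rightarrow> ('c, 'n, 'o) family \<Rightarrow> ('c, 'n, 'o) family \<Rightarrow> bool"
  where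
  "normalizable A d \<Gamma> \<Delta> \<longleftrightarrow>
     (\<exists>d'. (rewrite A)\<^sup>*\<^sup>* d d' \<and> derives A d' \<Gamma> \<Delta> \<and> only_essential_cuts A d')"

lemma normalizable_rewrite:
  assumes "rewrite A d e" "normalizable A e \<Gamma> \<Delta>"
  shows "normalizable A d \<Gamma> \<Delta>"
  using assms unfolding normalizable_def by (meson converse_rtranclp_into_rtranclp)

section \<open>Reduction inside subderivations\<close>

lemma rtranclp_context:
  assumes "\<And>x y. R x y \<Longrightarrow> R (C x) (C y)" and "R\<^sup>*\<^sup>* x y"
  shows "R\<^sup>*\<^sup>* (C x) (C y)"
  using assms(2) by induction (auto intro: assms(1) rtranclp.rtrancl_into_rtrancl)

text \<open>A rewrite step changes a single component, so a family is reduced one key at a time;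
  finiteness of the map makes this terminate.\<close>

lemma rtranclp_fmap_context:
  assumes "\<And>m k x y. fmlookup m k = Some x \<Longrightarrow> R x y \<Longrightarrow> R (C m) (C (fmupd k y m))"
    and "fmrel R\<^sup>*\<^sup>* m m'"
  shows "R\<^sup>*\<^sup>* (C m) (C m')"
proof -
  have upd: "R\<^sup>*\<^sup>* (C m) (C (fmupd k y m))" if "R\<^sup>*\<^sup>* x y" "fmlookup m k = Some x" for m k x y
    using that
  proof induction
    case base
    then have "fmupd k x m = m" by (intro fmap_ext) auto
    then show ?case by simp
  next
    case (step y z)
    have "R (C (fmupd k y m)) (C (fmupd k z (fmupd k y m)))"
      using step by (intro assms(1)) auto
    then show ?case using step by simp
  qed
  \<comment> \<open>\<open>K\<close> bounds the keys at which the current family may still differ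
    from the fixed target \<open>m'\<close>; each induction step settles one of them.\<close>
  have "R\<^sup>*\<^sup>* (C m) (C m')"
    if "finite K" "fmrel R\<^sup>*\<^sup>* m m'" "\<And>k. k \<notin> K \<Longrightarrow> fmlookup m k = fmlookup m' k" for K m
    using that
  proof (induction K arbitrary: m)
    case empty
    then have "m = m'" by (intro fmap_ext) auto
    then show ?case by simp
  next
    case (insert k K)
    show ?case
    proof (cases "fmlookup m k")
      case None
      then have "fmlookup m' k = None" using fmrelD[OF insert.prems(1), of k] by simp
      then show ?thesis using None insert by (metis insertE)
    next
      case (Some x)
      then obtain y where y: "fmlookup m' k = Some y" "R\<^sup>*\<^sup>* x y"
        using fmrelD[OF insert.prems(1), of k] by (auto simp: option_rel_Some1)
      have "R\<^sup>*\<^sup>* (C (fmupd k y m)) (C m')"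
      proof (rule insert.IH)
        show "fmrel R\<^sup>*\<^sup>* (fmupd k y m) m'"
          using fmrelD[OF insert.prems(1)] y(1) by (intro fmrelI) auto
        show "fmlookup (fmupd k y m) l = fmlookup m' l" if "l \<notin> K" for l
          using that y(1) insert.prems(2)[of l] by auto
      qed
      with upd[OF y(2) Some] show ?thesis by (rule rtranclp_trans)
    qed
  qed
  from this[of "fmdom' m \<union> fmdom' m'" m] show ?thesis
    using assms(2) by (auto simp: fmlookup_dom'_iff)
qed

lemma rewrites_Cotuple:
  "fmrel (rewrite A)\<^sup>*\<^sup>* fs fs' \<Longrightarrow> (rewrite A)\<^sup>*\<^sup>* (Cotuple \<alpha> fs) (Cotuple \<alpha> fs')"
  by (rule rtranclp_fmap_context[where C = "Cotuple \<alpha>"]) (rule rewrite.in_Cotuple)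

lemma rewrites_Tuple:
  "fmrel (rewrite A)\<^sup>*\<^sup>* fs fs' \<Longrightarrow> (rewrite A)\<^sup>*\<^sup>* (Tuple \<alpha> fs) (Tuple \<alpha> fs')"
  by (rule rtranclp_fmap_context[where C = "Tuple \<alpha>"]) (rule rewrite.in_Tuple)

lemma rewrites_Proj: "(rewrite A)\<^sup>*\<^sup>* f f' \<Longrightarrow> (rewrite A)\<^sup>*\<^sup>* (Proj \<alpha> k f) (Proj \<alpha> k f')"
  by (rule rtranclp_context[where C = "Proj \<alpha> k"]) (rule rewrite.in_Proj)

lemma rewrites_Inj: "(rewrite A)\<^sup>*\<^sup>* f f' \<Longrightarrow> (rewrite A)\<^sup>*\<^sup>* (Inj \<alpha> k f) (Inj \<alpha> k f')"
  by (rule rtranclp_context[where C = "Inj \<alpha> k"]) (rule rewrite.in_Inj)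

lemma rewrites_Cut:
  assumes "(rewrite A)\<^sup>*\<^sup>* f f'" "(rewrite A)\<^sup>*\<^sup>* g g'"
  shows "(rewrite A)\<^sup>*\<^sup>* (Cut f \<gamma> g) (Cut f' \<gamma> g')"
proof (rule rtranclp_trans)
  show "(rewrite A)\<^sup>*\<^sup>* (Cut f \<gamma> g) (Cut f' \<gamma> g)"
    using rewrite.in_Cut_left assms(1) by (rule rtranclp_context[where C = "\<lambda>f. Cut f \<gamma> g"])
  show "(rewrite A)\<^sup>*\<^sup>* (Cut f' \<gamma> g) (Cut f' \<gamma> g')"
    using rewrite.in_Cut_right assms(2) by (rule rtranclp_context[where C = "Cut f' \<gamma>"])
qed

text \<open>Selects normal forms for all components simultaneously and collects them in one finite
  map.\<close>

lemma normalizable_fmap: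
  assumes "fmrel (\<lambda>X f. normalizable A f (\<Gamma> X) (\<Delta> X)) Xs fs"
  obtains fs' where "fmrel (\<lambda>X f. derives A f (\<Gamma> X) (\<Delta> X)) Xs fs'"
    "\<And>f. f \<in> fmran' fs' \<Longrightarrow> only_essential_cuts A f" "fmrel (rewrite A)\<^sup>*\<^sup>* fs fs'"
proof -
  let ?Q = "\<lambda>X f. derives A f (\<Gamma> X) (\<Delta> X) \<and> only_essential_cuts A f"
  \<comment> \<open>Normalizability factors through the normal form as a relational composition.
    Since \<open>fmrel\<close> distributes over composition, the middle family supplies
    \<open>fs'\<close> without an explicit choice for each key.\<close>
  have "(\<lambda>X f. normalizable A f (\<Gamma> X) (\<Delta> X)) \<le> ?Q OO ((rewrite A)\<^sup>*\<^sup>*)\<inverse>\<inverse>"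
    by (auto simp: normalizable_def)
  from fmap.rel_mono[OF this] assms have "fmrel (?Q OO ((rewrite A)\<^sup>*\<^sup>*)\<inverse>\<inverse>) Xs fs" by auto
  then obtain fs' where Q: "fmrel ?Q Xs fs'" and R: "fmrel ((rewrite A)\<^sup>*\<^sup>*)\<inverse>\<inverse> fs' fs"
    unfolding fmap.rel_compp by auto
  show thesis
  proof
    show "fmrel (\<lambda>X f. derives A f (\<Gamma> X) (\<Delta> X)) Xs fs'"
      using Q by (rule fmap.rel_mono_strong) auto
    show "fmrel (rewrite A)\<^sup>*\<^sup>* fs fs'" using R unfolding fmap.rel_conversep by simp
    fix f assume "f \<in> fmran' fs'"
    then obtain k where "fmlookup fs' k = Some f" by (auto simp: fmlookup_ran'_iff)
    then show "only_essential_cuts A f"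
      using fmrelD[OF Q, of k] by (auto simp: option_rel_Some2)
  qed
qed

text \<open>Reducing the branches in place suffices, because a logical rule itself contributes no
  cut. The same holds for the next three lemmas.\<close>

lemma normalizable_Cotuple:
  assumes "fmlookup \<Gamma> \<alpha> = Some (Sum Xs)" "sequent A \<Gamma> \<Delta>"
    and "fmrel (\<lambda>X f. normalizable A f (fmupd \<alpha> X \<Gamma>) \<Delta>) Xs fs"
  shows "normalizable A (Cotuple \<alpha> fs) \<Gamma> \<Delta>"
  using assms(3)
proof (rule normalizable_fmap)
  fix fs' assume "fmrel (\<lambda>X f. derives A f (fmupd \<alpha> X \<Gamma>) \<Delta>) Xs fs'"
    "\<And>f. f \<in> fmran' fs' \<Longrightarrow> only_essential_cuts A f" "fmrel (rewrite A)\<^sup>*\<^sup>* fs fs'"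
  then show ?thesis
    unfolding normalizable_def using assms(1,2)
    by (blast intro: derives_CotupleI only_essential_cuts.intros rewrites_Cotuple)
qed

lemma normalizable_Tuple:
  assumes "fmlookup \<Delta> \<alpha> = Some (Prod Xs)" "sequent A \<Gamma> \<Delta>"
    and "fmrel (\<lambda>X f. normalizable A f \<Gamma> (fmupd \<alpha> X \<Delta>)) Xs fs"
  shows "normalizable A (Tuple \<alpha> fs) \<Gamma> \<Delta>"
  using assms(3)
proof (rule normalizable_fmap)
  fix fs' assume "fmrel (\<lambda>X f. derives A f \<Gamma> (fmupd \<alpha> X \<Delta>)) Xs fs'"
    "\<And>f. f \<in> fmran' fs' \<Longrightarrow> only_essential_cuts A f" "fmrel (rewrite A)\<^sup>*\<^sup>* fs fs'"
  then show ?thesis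
    unfolding normalizable_def using assms(1,2)
    by (blast intro: derives_TupleI only_essential_cuts.intros rewrites_Tuple)
qed

lemma normalizable_Proj:
  assumes "fmlookup \<Gamma> \<alpha> = Some (Prod Xs)" "sequent A \<Gamma> \<Delta>" "fmlookup Xs k = Some X"
    and "normalizable A f (fmupd \<alpha> X \<Gamma>) \<Delta>"
  shows "normalizable A (Proj \<alpha> k f) \<Gamma> \<Delta>"
  using assms unfolding normalizable_def
  by (blast intro: derives_ProjI only_essential_cuts.intros rewrites_Proj)

lemma normalizable_Inj:
  assumes "fmlookup \<Delta> \<alpha> = Some (Sum Xs)" "sequent A \<Gamma> \<Delta>" "fmlookup Xs k = Some X"
    and "normalizable A f \<Gamma> (fmupd \<alpha> X \<Delta>)"
  shows "normalizable A (Inj \<alpha> k f) \<Gamma> \<Delta>"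
  using assms unfolding normalizable_def
  by (blast intro: derives_InjI only_essential_cuts.intros rewrites_Inj)

section \<open>Cuts between derivations with only essential cuts\<close>

text \<open>\<open>++\<^sub>f\<close> prefers its right argument. This guarantees that a formula of
  the left premise other than the cut formula is not overwritten in the conclusion.\<close>

lemma cuttable_side:
  assumes "cuttable \<gamma> \<Gamma>1 \<Delta>1 \<Gamma>2 \<Delta>2" "\<alpha> \<noteq> \<gamma>"
  shows "fmlookup \<Gamma>1 \<alpha> = Some Y \<Longrightarrow> fmlookup \<Gamma>2 \<alpha> = None \<and> fmlookup \<Delta>2 \<alpha> = None"
    and "fmlookup \<Delta>1 \<alpha> = Some Y \<Longrightarrow> fmlookup \<Gamma>2 \<alpha> = None \<and> fmlookup \<Delta>2 \<alpha> = None"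
proof -
  have "\<alpha> \<in> channels \<Gamma>1 \<Delta>1 \<Longrightarrow> \<alpha> \<notin> channels \<Gamma>2 \<Delta>2" using assms unfolding cuttable_def by blast
  then show "fmlookup \<Gamma>1 \<alpha> = Some Y \<Longrightarrow> fmlookup \<Gamma>2 \<alpha> = None \<and> fmlookup \<Delta>2 \<alpha> = None"
    and "fmlookup \<Delta>1 \<alpha> = Some Y \<Longrightarrow> fmlookup \<Gamma>2 \<alpha> = None \<and> fmlookup \<Delta>2 \<alpha> = None"
    by (auto simp: channels_def fmdom'I dest: fmdom'_notD)
qed

text \<open>Passing from the conclusion of a logical rule to a premise replaces a formula at an
  existing channel, so the channel sets stay the same; \<alpha> \<noteq> \<gamma> protects the cut
  formula.\<close>

lemma cuttable_update:
  assumes "cuttable \<gamma> \<Gamma>1 \<Delta>1 \<Gamma>2 \<Delta>2" "\<alpha> \<noteq> \<gamma>"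
  shows "fmlookup \<Gamma>1 \<alpha> = Some Y \<Longrightarrow> cuttable \<gamma> (fmupd \<alpha> X \<Gamma>1) \<Delta>1 \<Gamma>2 \<Delta>2"
    and "fmlookup \<Delta>1 \<alpha> = Some Y \<Longrightarrow> cuttable \<gamma> \<Gamma>1 (fmupd \<alpha> X \<Delta>1) \<Gamma>2 \<Delta>2"
    and "fmlookup \<Gamma>2 \<alpha> = Some Y \<Longrightarrow> cuttable \<gamma> \<Gamma>1 \<Delta>1 (fmupd \<alpha> X \<Gamma>2) \<Delta>2"
    and "fmlookup \<Delta>2 \<alpha> = Some Y \<Longrightarrow> cuttable \<gamma> \<Gamma>1 \<Delta>1 \<Gamma>2 (fmupd \<alpha> X \<Delta>2)"
  using assms by (auto simp: cuttable_def channels_def insert_absorb fmdom'I)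

text \<open>For (11) and (12): both occurrences of the cut formula are replaced by the same
  component.\<close>

lemma cuttable_principal:
  assumes "cuttable \<gamma> \<Gamma>1 \<Delta>1 \<Gamma>2 \<Delta>2"
  shows "cuttable \<gamma> \<Gamma>1 (fmupd \<gamma> X \<Delta>1) (fmupd \<gamma> X \<Gamma>2) \<Delta>2"
  using assms by (auto simp: cuttable_def channels_def)

text \<open>Moves the change of a side formula from a premise to the conclusion of the cut, as the
  commuting rewrites require. The first two parts ask for freshness on the right because the right
  family wins in \<open>++\<^sub>f\<close>.\<close>

lemma fmupd_cut:
  shows "\<alpha> \<noteq> \<gamma> \<Longrightarrow> fmlookup \<Gamma>2 \<alpha> = None \<Longrightarrow>
      fmupd \<alpha> X \<Gamma>1 ++\<^sub>f fmdrop \<gamma> \<Gamma>2 = fmupd \<alpha> X (\<Gamma>1 ++\<^sub>f fmdrop \<gamma> \<Gamma>2)"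
    and "\<alpha> \<noteq> \<gamma> \<Longrightarrow> fmlookup \<Delta>2 \<alpha> = None \<Longrightarrow>
      fmdrop \<gamma> (fmupd \<alpha> X \<Delta>1) ++\<^sub>f \<Delta>2 = fmupd \<alpha> X (fmdrop \<gamma> \<Delta>1 ++\<^sub>f \<Delta>2)"
    and "\<alpha> \<noteq> \<gamma> \<Longrightarrow> \<Gamma>1 ++\<^sub>f fmdrop \<gamma> (fmupd \<alpha> X \<Gamma>2) = fmupd \<alpha> X (\<Gamma>1 ++\<^sub>f fmdrop \<gamma> \<Gamma>2)"
  by (rule fmap_ext; auto simp: fmlookup_dom_iff)+

text \<open>Excludes a cut of an axiom against a premise that introduces the cut formula by a
  logical rule.\<close>

lemma axiom_of_atomic:
  assumes "polycategory A" "axiom_of A d f" "derives A d \<Gamma> \<Delta>"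
  shows "fmlookup \<Gamma> \<alpha> = Some X \<Longrightarrow> \<exists>a. X = Atom a" "fmlookup \<Delta> \<alpha> = Some X \<Longrightarrow> \<exists>a. X = Atom a"
  using axiom_of_derives[OF assms] by auto

section \<open>Immediate subderivations\<close>

primrec immediate :: "('c, 'n, 'm) deriv \<Rightarrow> ('c, 'n, 'm) deriv set" where
  "immediate (Ax f) = {}"
| "immediate (Cotuple \<alpha> fs) = fmran' fs"
| "immediate (Tuple \<alpha> fs) = fmran' fs"
| "immediate (Proj \<alpha> k f) = {f}"
| "immediate (Inj \<alpha> k f) = {f}"
| "immediate (Cut f \<gamma> g) = {f, g}"

text \<open>Structural induction with one uniform hypothesis for all constructors, so that the
  analysis of a cut can be stated separately from the inductions.\<close>

lemma immediate_induct:
  assumes "\<And>d. (\<And>e. e \<in> immediate d \<Longrightarrow> P e) \<Longrightarrow> P d"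
  shows "P d"
  by (induction d) (rule assms; auto)+

lemma only_essential_cuts_immediate:
  "only_essential_cuts A d \<Longrightarrow> e \<in> immediate d \<Longrightarrow> only_essential_cuts A e"
  by (cases rule: only_essential_cuts.cases) auto

text \<open>Both premises of an essential cut are axioms, so composing them gives an axiom again;
  inner cuts of a normal derivation can therefore be treated like \<open>Ax\<close>.\<close>

lemma only_essential_cuts_Cut:
  assumes "only_essential_cuts A (Cut f \<gamma> g)"
  obtains m where "axiom_of A (Cut f \<gamma> g) m"
  using assms
  by (cases rule: only_essential_cuts.cases) (auto simp: essential_cut_def intro: axiom_of.intros)

section \<open>A single cut whose premises have only essential cuts\<close>

context
  fixes A :: "('c, 'o, 'm) polycat" and \<gamma> :: 'c and f g :: "('c, 'n, 'm) deriv"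
    and \<Gamma>1 \<Delta>1 \<Gamma>2 \<Delta>2 :: "('c, 'n, 'o) family"
  assumes A: "polycategory A"
    and cuttable: "cuttable \<gamma> \<Gamma>1 \<Delta>1 \<Gamma>2 \<Delta>2"
    and f: "derives A f \<Gamma>1 \<Delta>1" "only_essential_cuts A f"
    and g: "derives A g \<Gamma>2 \<Delta>2" "only_essential_cuts A g"
begin

private lemma conclusion: "sequent A (\<Gamma>1 ++\<^sub>f fmdrop \<gamma> \<Gamma>2) (fmdrop \<gamma> \<Delta>1 ++\<^sub>f \<Delta>2)"
  using sequent_cut[OF cuttable] derives_sequent[OF A] f(1) g(1) by blast

text \<open>\<open>\<gamma>\<close> is an output of \<open>f\<close> and an input of
  \<open>g\<close>, and the two sides of a sequent are disjoint. Hence left rules ending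
  \<open>f\<close> and right rules ending \<open>g\<close> never act at
  \<open>\<gamma>\<close>.\<close>

private lemma cut_formula:
  "fmlookup \<Gamma>1 \<gamma> = None" "fmlookup \<Delta>2 \<gamma> = None"
  using cuttable derives_sequent[OF A f(1)] derives_sequent[OF A g(1)]
  by (auto simp: cuttable_def sequent_def disjoint_iff fmlookup_dom'_iff)

text \<open>If \<open>f\<close> ends with a logical rule away from \<open>\<gamma>\<close>, the cut
  moves into its premises by (3), (5), (7) or (9), and the hypothesis applies with \<open>g\<close>
  unchanged. What remains is an axiom or a right rule introducing the cut formula.\<close>

lemma cut_left_cases:
  assumes IH: "\<And>f' \<Gamma>1 \<Delta>1. f' \<in> immediate f \<Longrightarrow> cuttable \<gamma> \<Gamma>1 \<Delta>1 \<Gamma>2 \<Delta>2 \<Longrightarrow> derives A f' \<Gamma>1 \<Delta>1 \<Longrightarrow>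
    normalizable A (Cut f' \<gamma> g) (\<Gamma>1 ++\<^sub>f fmdrop \<gamma> \<Gamma>2) (fmdrop \<gamma> \<Delta>1 ++\<^sub>f \<Delta>2)"
  obtains (normalizable) "normalizable A (Cut f \<gamma> g) (\<Gamma>1 ++\<^sub>f fmdrop \<gamma> \<Gamma>2) (fmdrop \<gamma> \<Delta>1 ++\<^sub>f \<Delta>2)"
  | (axiom) m where "axiom_of A f m"
  | (Inj) k f' where "f = Inj \<gamma> k f'"
  | (Tuple) fs where "f = Tuple \<gamma> fs"
proof (cases f)
  case (Ax m)
  then show thesis by (intro axiom) (auto intro: axiom_of.intros)
next
  case (Cut d \<delta> e)
  then show thesis using f(2) only_essential_cuts_Cut axiom by metis
next
  case (Cotuple \<alpha> fs)
  with f(1) obtain Xs where Xs: "fmlookup \<Gamma>1 \<alpha> = Some (Sum Xs)"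
    and fs: "fmrel (\<lambda>X f. derives A f (fmupd \<alpha> X \<Gamma>1) \<Delta>1) Xs fs"
    by (auto elim: derives_CotupleE)
  have ne: "\<alpha> \<noteq> \<gamma>" using Xs cut_formula by auto
  note side = cuttable_side(1)[OF cuttable ne Xs]
  have "normalizable A (Cut f \<gamma> g) (\<Gamma>1 ++\<^sub>f fmdrop \<gamma> \<Gamma>2) (fmdrop \<gamma> \<Delta>1 ++\<^sub>f \<Delta>2)"
    unfolding Cotuple
  proof (intro normalizable_rewrite[OF rewrite.r3] ne normalizable_Cotuple conclusion)
    show "fmlookup (\<Gamma>1 ++\<^sub>f fmdrop \<gamma> \<Gamma>2) \<alpha> = Some (Sum Xs)"
      using Xs side by (simp add: fmlookup_dom_iff)
    show "fmrel (\<lambda>X f. normalizable A f (fmupd \<alpha> X (\<Gamma>1 ++\<^sub>f fmdrop \<gamma> \<Gamma>2)) (fmdrop \<gamma> \<Delta>1 ++\<^sub>f \<Delta>2))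
      Xs (fmmap (\<lambda>f. Cut f \<gamma> g) fs)"
      \<comment> \<open>The cuts are absorbed into the relation, leaving one obligation for each
        branch of the original cotuple.\<close>
      unfolding fmap.rel_map
    proof (rule fmap.rel_mono_strong[OF fs])
      fix X f' assume "f' \<in> fmran' fs" "derives A f' (fmupd \<alpha> X \<Gamma>1) \<Delta>1"
      then show "normalizable A (Cut f' \<gamma> g)
          (fmupd \<alpha> X (\<Gamma>1 ++\<^sub>f fmdrop \<gamma> \<Gamma>2)) (fmdrop \<gamma> \<Delta>1 ++\<^sub>f \<Delta>2)"
        using IH[OF _ cuttable_update(1)[OF cuttable ne Xs]] Cotuple fmupd_cut(1)[OF ne] side
        by (metis immediate.simps(2))
    qed
  qed
  then show thesis by (rule normalizable)
next
  case (Tuple \<alpha> fs)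
  show thesis
  proof (cases "\<alpha> = \<gamma>")
    case True
    then show thesis using Tuple that(4) by simp
  next
    case ne: False
    from Tuple f(1) obtain Xs where Xs: "fmlookup \<Delta>1 \<alpha> = Some (Prod Xs)"
      and fs: "fmrel (\<lambda>X f. derives A f \<Gamma>1 (fmupd \<alpha> X \<Delta>1)) Xs fs"
      by (auto elim: derives_TupleE)
    note side = cuttable_side(2)[OF cuttable ne Xs]
    have "normalizable A (Cut f \<gamma> g) (\<Gamma>1 ++\<^sub>f fmdrop \<gamma> \<Gamma>2) (fmdrop \<gamma> \<Delta>1 ++\<^sub>f \<Delta>2)"
      unfolding Tuple
    proof (intro normalizable_rewrite[OF rewrite.r9] ne normalizable_Tuple conclusion)
      show "fmlookup (fmdrop \<gamma> \<Delta>1 ++\<^sub>f \<Delta>2) \<alpha> = Some (Prod Xs)"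
        using Xs side ne by (simp add: fmlookup_dom_iff)
      show "fmrel (\<lambda>X f. normalizable A f (\<Gamma>1 ++\<^sub>f fmdrop \<gamma> \<Gamma>2)
          (fmupd \<alpha> X (fmdrop \<gamma> \<Delta>1 ++\<^sub>f \<Delta>2))) Xs (fmmap (\<lambda>f. Cut f \<gamma> g) fs)"
        unfolding fmap.rel_map
      proof (rule fmap.rel_mono_strong[OF fs])
        fix X f' assume "f' \<in> fmran' fs" "derives A f' \<Gamma>1 (fmupd \<alpha> X \<Delta>1)"
        then show "normalizable A (Cut f' \<gamma> g)
            (\<Gamma>1 ++\<^sub>f fmdrop \<gamma> \<Gamma>2) (fmupd \<alpha> X (fmdrop \<gamma> \<Delta>1 ++\<^sub>f \<Delta>2))"
          using IH[OF _ cuttable_update(2)[OF cuttable ne Xs]] Tuple fmupd_cut(2)[OF ne] side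
          by (metis immediate.simps(3))
      qed
    qed
    then show thesis by (rule normalizable)
  qed
next
  case (Proj \<alpha> k f')
  with f(1) obtain Xs X where Xs: "fmlookup \<Gamma>1 \<alpha> = Some (Prod Xs)" "fmlookup Xs k = Some X"
    and f': "derives A f' (fmupd \<alpha> X \<Gamma>1) \<Delta>1"
    by (auto elim: derives_ProjE)
  have ne: "\<alpha> \<noteq> \<gamma>" using Xs cut_formula by auto
  note side = cuttable_side(1)[OF cuttable ne Xs(1)]
  have "fmlookup (\<Gamma>1 ++\<^sub>f fmdrop \<gamma> \<Gamma>2) \<alpha> = Some (Prod Xs)"
    using Xs side by (simp add: fmlookup_dom_iff)
  moreover have "normalizable A (Cut f' \<gamma> g)
      (fmupd \<alpha> X (\<Gamma>1 ++\<^sub>f fmdrop \<gamma> \<Gamma>2)) (fmdrop \<gamma> \<Delta>1 ++\<^sub>f \<Delta>2)"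
    using IH[OF _ cuttable_update(1)[OF cuttable ne Xs(1)] f'] Proj side by (simp add: fmupd_cut(1)[OF ne])
  ultimately have "normalizable A (Cut f \<gamma> g) (\<Gamma>1 ++\<^sub>f fmdrop \<gamma> \<Gamma>2) (fmdrop \<gamma> \<Delta>1 ++\<^sub>f \<Delta>2)"
    unfolding Proj
    by (intro normalizable_rewrite[OF rewrite.r7[OF ne]] normalizable_Proj[OF _ conclusion Xs(2)])
  then show thesis by (rule normalizable)
next
  case (Inj \<alpha> k f')
  show thesis
  proof (cases "\<alpha> = \<gamma>")
    case True
    then show thesis using Inj that(3) by simp
  next
    case ne: False
    from Inj f(1) obtain Xs X where Xs: "fmlookup \<Delta>1 \<alpha> = Some (Sum Xs)" "fmlookup Xs k = Some X"
      and f': "derives A f' \<Gamma>1 (fmupd \<alpha> X \<Delta>1)"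
      by (auto elim: derives_InjE)
    note side = cuttable_side(2)[OF cuttable ne Xs(1)]
    have "fmlookup (fmdrop \<gamma> \<Delta>1 ++\<^sub>f \<Delta>2) \<alpha> = Some (Sum Xs)"
      using Xs side ne by (simp add: fmlookup_dom_iff)
    moreover have "normalizable A (Cut f' \<gamma> g)
        (\<Gamma>1 ++\<^sub>f fmdrop \<gamma> \<Gamma>2) (fmupd \<alpha> X (fmdrop \<gamma> \<Delta>1 ++\<^sub>f \<Delta>2))"
      using IH[OF _ cuttable_update(2)[OF cuttable ne Xs(1)] f'] Inj side by (simp add: fmupd_cut(2)[OF ne])
    ultimately have "normalizable A (Cut f \<gamma> g) (\<Gamma>1 ++\<^sub>f fmdrop \<gamma> \<Gamma>2) (fmdrop \<gamma> \<Delta>1 ++\<^sub>f \<Delta>2)"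
      unfolding Inj
      by (intro normalizable_rewrite[OF rewrite.r5[OF ne]] normalizable_Inj[OF _ conclusion Xs(2)])
    then show thesis by (rule normalizable)
  qed
qed

text \<open>The mirror image, with \<open>f\<close> unchanged: (4), (6), (8) and (10) move the cut
  into \<open>g\<close>, leaving an axiom or a left rule introducing the cut formula.\<close>

lemma cut_right_cases:
  assumes IH: "\<And>g' \<Gamma>2 \<Delta>2. g' \<in> immediate g \<Longrightarrow> cuttable \<gamma> \<Gamma>1 \<Delta>1 \<Gamma>2 \<Delta>2 \<Longrightarrow> derives A g' \<Gamma>2 \<Delta>2 \<Longrightarrow>
    normalizable A (Cut f \<gamma> g') (\<Gamma>1 ++\<^sub>f fmdrop \<gamma> \<Gamma>2) (fmdrop \<gamma> \<Delta>1 ++\<^sub>f \<Delta>2)"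
  obtains (normalizable) "normalizable A (Cut f \<gamma> g) (\<Gamma>1 ++\<^sub>f fmdrop \<gamma> \<Gamma>2) (fmdrop \<gamma> \<Delta>1 ++\<^sub>f \<Delta>2)"
  | (axiom) m where "axiom_of A g m"
  | (Proj) k g' where "g = Proj \<gamma> k g'"
  | (Cotuple) gs where "g = Cotuple \<gamma> gs"
proof (cases g)
  case (Ax m)
  then show thesis by (intro axiom) (auto intro: axiom_of.intros)
next
  case (Cut d \<delta> e)
  then show thesis using g(2) only_essential_cuts_Cut axiom by metis
next
  case (Tuple \<beta> gs)
  with g(1) obtain Xs where Xs: "fmlookup \<Delta>2 \<beta> = Some (Prod Xs)"
    and gs: "fmrel (\<lambda>X g. derives A g \<Gamma>2 (fmupd \<beta> X \<Delta>2)) Xs gs"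
    by (auto elim: derives_TupleE)
  have ne: "\<beta> \<noteq> \<gamma>" using Xs cut_formula by auto
  have "normalizable A (Cut f \<gamma> g) (\<Gamma>1 ++\<^sub>f fmdrop \<gamma> \<Gamma>2) (fmdrop \<gamma> \<Delta>1 ++\<^sub>f \<Delta>2)"
    unfolding Tuple
  proof (intro normalizable_rewrite[OF rewrite.r4] ne normalizable_Tuple conclusion)
    show "fmlookup (fmdrop \<gamma> \<Delta>1 ++\<^sub>f \<Delta>2) \<beta> = Some (Prod Xs)"
      using Xs by (simp add: fmdomI)
    show "fmrel (\<lambda>X g. normalizable A g (\<Gamma>1 ++\<^sub>f fmdrop \<gamma> \<Gamma>2)
        (fmupd \<beta> X (fmdrop \<gamma> \<Delta>1 ++\<^sub>f \<Delta>2))) Xs (fmmap (\<lambda>g. Cut f \<gamma> g) gs)"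
      unfolding fmap.rel_map
    proof (rule fmap.rel_mono_strong[OF gs])
      fix X g' assume "g' \<in> fmran' gs" "derives A g' \<Gamma>2 (fmupd \<beta> X \<Delta>2)"
      then show "normalizable A (Cut f \<gamma> g')
          (\<Gamma>1 ++\<^sub>f fmdrop \<gamma> \<Gamma>2) (fmupd \<beta> X (fmdrop \<gamma> \<Delta>1 ++\<^sub>f \<Delta>2))"
        using IH[OF _ cuttable_update(4)[OF cuttable ne Xs]] Tuple
        by (metis immediate.simps(3) fmadd_fmupd)
    qed
  qed
  then show thesis by (rule normalizable)
next
  case (Cotuple \<beta> gs)
  show thesis
  proof (cases "\<beta> = \<gamma>")
    case True
    then show thesis using Cotuple that(4) by simp
  next
    case ne: False
    from Cotuple g(1) obtain Xs where Xs: "fmlookup \<Gamma>2 \<beta> = Some (Sum Xs)"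
      and gs: "fmrel (\<lambda>X g. derives A g (fmupd \<beta> X \<Gamma>2) \<Delta>2) Xs gs"
      by (auto elim: derives_CotupleE)
    have "normalizable A (Cut f \<gamma> g) (\<Gamma>1 ++\<^sub>f fmdrop \<gamma> \<Gamma>2) (fmdrop \<gamma> \<Delta>1 ++\<^sub>f \<Delta>2)"
      unfolding Cotuple
    proof (intro normalizable_rewrite[OF rewrite.r10] ne normalizable_Cotuple conclusion)
      show "fmlookup (\<Gamma>1 ++\<^sub>f fmdrop \<gamma> \<Gamma>2) \<beta> = Some (Sum Xs)"
        using Xs ne by (simp add: fmdomI)
      show "fmrel (\<lambda>X g. normalizable A g (fmupd \<beta> X (\<Gamma>1 ++\<^sub>f fmdrop \<gamma> \<Gamma>2))
          (fmdrop \<gamma> \<Delta>1 ++\<^sub>f \<Delta>2)) Xs (fmmap (\<lambda>g. Cut f \<gamma> g) gs)"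
        unfolding fmap.rel_map
      proof (rule fmap.rel_mono_strong[OF gs])
        fix X g' assume "g' \<in> fmran' gs" "derives A g' (fmupd \<beta> X \<Gamma>2) \<Delta>2"
        then show "normalizable A (Cut f \<gamma> g')
            (fmupd \<beta> X (\<Gamma>1 ++\<^sub>f fmdrop \<gamma> \<Gamma>2)) (fmdrop \<gamma> \<Delta>1 ++\<^sub>f \<Delta>2)"
          using IH[OF _ cuttable_update(3)[OF cuttable ne Xs]] Cotuple fmupd_cut(3)[OF ne]
          by (metis immediate.simps(2))
      qed
    qed
    then show thesis by (rule normalizable)
  qed
next
  case (Inj \<beta> k g')
  with g(1) obtain Xs X where Xs: "fmlookup \<Delta>2 \<beta> = Some (Sum Xs)" "fmlookup Xs k = Some X"
    and g': "derives A g' \<Gamma>2 (fmupd \<beta> X \<Delta>2)"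
    by (auto elim: derives_InjE)
  have ne: "\<beta> \<noteq> \<gamma>" using Xs cut_formula by auto
  have "fmlookup (fmdrop \<gamma> \<Delta>1 ++\<^sub>f \<Delta>2) \<beta> = Some (Sum Xs)"
    using Xs by (simp add: fmdomI)
  moreover have "normalizable A (Cut f \<gamma> g')
      (\<Gamma>1 ++\<^sub>f fmdrop \<gamma> \<Gamma>2) (fmupd \<beta> X (fmdrop \<gamma> \<Delta>1 ++\<^sub>f \<Delta>2))"
    using IH[OF _ cuttable_update(4)[OF cuttable ne Xs(1)] g'] Inj by simp
  ultimately have "normalizable A (Cut f \<gamma> g) (\<Gamma>1 ++\<^sub>f fmdrop \<gamma> \<Gamma>2) (fmdrop \<gamma> \<Delta>1 ++\<^sub>f \<Delta>2)"
    unfolding Inj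
    by (intro normalizable_rewrite[OF rewrite.r8[OF ne]] normalizable_Inj[OF _ conclusion Xs(2)])
  then show thesis by (rule normalizable)
next
  case (Proj \<beta> k g')
  show thesis
  proof (cases "\<beta> = \<gamma>")
    case True
    then show thesis using Proj that(3) by simp
  next
    case ne: False
    from Proj g(1) obtain Xs X where Xs: "fmlookup \<Gamma>2 \<beta> = Some (Prod Xs)" "fmlookup Xs k = Some X"
      and g': "derives A g' (fmupd \<beta> X \<Gamma>2) \<Delta>2"
      by (auto elim: derives_ProjE)
    have "fmlookup (\<Gamma>1 ++\<^sub>f fmdrop \<gamma> \<Gamma>2) \<beta> = Some (Prod Xs)"
      using Xs ne by (simp add: fmdomI)
    moreover have "normalizable A (Cut f \<gamma> g')
        (fmupd \<beta> X (\<Gamma>1 ++\<^sub>f fmdrop \<gamma> \<Gamma>2)) (fmdrop \<gamma> \<Delta>1 ++\<^sub>f \<Delta>2)"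
      using IH[OF _ cuttable_update(3)[OF cuttable ne Xs(1)] g'] Proj by (simp add: fmupd_cut(3)[OF ne])
    ultimately have "normalizable A (Cut f \<gamma> g) (\<Gamma>1 ++\<^sub>f fmdrop \<gamma> \<Gamma>2) (fmdrop \<gamma> \<Delta>1 ++\<^sub>f \<Delta>2)"
      unfolding Proj
      by (intro normalizable_rewrite[OF rewrite.r6[OF ne]] normalizable_Proj[OF _ conclusion Xs(2)])
    then show thesis by (rule normalizable)
  qed
qed

text \<open>Combines the two case analyses. \<open>IHf\<close> lets the right premise and all
  contexts vary, since (11) and (12) shrink both premises at once; \<open>IHg\<close> keeps
  \<open>f\<close> and its sequent.\<close>

lemma cut_step:
  assumes IHf: "\<And>f' g' \<Gamma>1 \<Delta>1 \<Gamma>2 \<Delta>2. f' \<in> immediate f \<Longrightarrow> only_essential_cuts A g' \<Longrightarrow>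
      cuttable \<gamma> \<Gamma>1 \<Delta>1 \<Gamma>2 \<Delta>2 \<Longrightarrow> derives A f' \<Gamma>1 \<Delta>1 \<Longrightarrow> derives A g' \<Gamma>2 \<Delta>2 \<Longrightarrow>
      normalizable A (Cut f' \<gamma> g') (\<Gamma>1 ++\<^sub>f fmdrop \<gamma> \<Gamma>2) (fmdrop \<gamma> \<Delta>1 ++\<^sub>f \<Delta>2)"
    and IHg: "\<And>g' \<Gamma>2 \<Delta>2. g' \<in> immediate g \<Longrightarrow>
      cuttable \<gamma> \<Gamma>1 \<Delta>1 \<Gamma>2 \<Delta>2 \<Longrightarrow> derives A g' \<Gamma>2 \<Delta>2 \<Longrightarrow>
      normalizable A (Cut f \<gamma> g') (\<Gamma>1 ++\<^sub>f fmdrop \<gamma> \<Gamma>2) (fmdrop \<gamma> \<Delta>1 ++\<^sub>f \<Delta>2)"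
  shows "normalizable A (Cut f \<gamma> g) (\<Gamma>1 ++\<^sub>f fmdrop \<gamma> \<Gamma>2) (fmdrop \<gamma> \<Delta>1 ++\<^sub>f \<Delta>2)"
proof -
  obtain Z where Z: "fmlookup \<Delta>1 \<gamma> = Some Z" "fmlookup \<Gamma>2 \<gamma> = Some Z"
    using cuttable by (auto simp: cuttable_def)
  \<comment> \<open>Common to (11) and (12). The component \<open>X\<close> replaces the formula
    only at \<open>\<gamma>\<close>, which the cut drops, so the new cut has the same conclusion as
    the old one.\<close>
  have principal: "normalizable A (Cut f' \<gamma> g') (\<Gamma>1 ++\<^sub>f fmdrop \<gamma> \<Gamma>2) (fmdrop \<gamma> \<Delta>1 ++\<^sub>f \<Delta>2)"
    if "f' \<in> immediate f" "g' \<in> immediate g"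
      "derives A f' \<Gamma>1 (fmupd \<gamma> X \<Delta>1)" "derives A g' (fmupd \<gamma> X \<Gamma>2) \<Delta>2" for f' g' X
    using IHf[OF that(1) only_essential_cuts_immediate[OF g(2) that(2)]
        cuttable_principal[OF cuttable] that(3,4)]
    by (simp add: fmdrop_fmupd_same)
  show ?thesis
  proof (rule cut_left_cases, goal_cases IH normalizable axiom Inj Tuple)
    case IH
    then show ?case using IHf g by blast
  next
    case normalizable
    then show ?thesis .
  next
    case left: (axiom m)
    show ?thesis
    proof (rule cut_right_cases, goal_cases IH normalizable axiom Proj Cotuple)
      case IH
      then show ?case using IHg by blast
    next
      case normalizable
      then show ?thesis .
    next
      case (axiom n)
      \<comment> \<open>Two axioms form an essential cut: the derivation is already normal and no
        rewrite is made.\<close>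
      then have "only_essential_cuts A (Cut f \<gamma> g)"
        using left f(2) g(2) by (intro only_essential_cuts.intros(6)) (auto simp: essential_cut_def)
      then show ?thesis
        unfolding normalizable_def using derives_CutI[OF cuttable f(1) g(1)] by blast
    next
      case (Proj k g')
      \<comment> \<open>Impossible: \<open>Z\<close> is atomic on the left and a product on the
        right.\<close>
      then show ?thesis
        using g(1) Z axiom_of_atomic(2)[OF A left f(1), of \<gamma>] by (auto elim: derives_ProjE)
    next
      case (Cotuple gs)
      then show ?thesis
        using g(1) Z axiom_of_atomic(2)[OF A left f(1), of \<gamma>] by (auto elim: derives_CotupleE)
    qed
  next
    case left: (Inj k f')
    with f(1) obtain Xs X where Xs: "fmlookup \<Delta>1 \<gamma> = Some (Sum Xs)" "fmlookup Xs k = Some X"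
      and f': "derives A f' \<Gamma>1 (fmupd \<gamma> X \<Delta>1)" by (auto elim: derives_InjE)
    show ?thesis
    proof (rule cut_right_cases, goal_cases IH normalizable axiom Proj Cotuple)
      case IH
      then show ?case using IHg by blast
    next
      case normalizable
      then show ?thesis .
    next
      case (axiom n)
      then show ?thesis using Z Xs axiom_of_atomic(1)[OF A axiom g(1), of \<gamma>] by auto
    next
      case (Proj k g')
      \<comment> \<open>Impossible: \<open>Z\<close> would be both a sum and a product.\<close>
      then show ?thesis using g(1) Z Xs by (auto elim: derives_ProjE)
    next
      case (Cotuple gs)
      \<comment> \<open>Both premises see the same \<open>Z\<close>, so the branches of the cotuple
        are indexed by the very family from which the injection picks \<open>k\<close>. Branch
        \<open>k\<close> thus exists and derives from the same component \<open>X\<close>.\<close>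
      with g(1) Z Xs(1) have "fmrel (\<lambda>X g. derives A g (fmupd \<gamma> X \<Gamma>2) \<Delta>2) Xs gs"
        by (auto elim: derives_CotupleE)
      from fmrelD[OF this, of k] Xs(2) obtain g' where
        g': "fmlookup gs k = Some g'" "derives A g' (fmupd \<gamma> X \<Gamma>2) \<Delta>2"
        by (auto simp: option_rel_Some1)
      then show ?thesis
        unfolding left Cotuple using f' left Cotuple
        by (intro normalizable_rewrite[OF rewrite.r11] principal) (auto intro: fmran'I)
    qed
  next
    case left: (Tuple fs)
    with f(1) obtain Xs where Xs: "fmlookup \<Delta>1 \<gamma> = Some (Prod Xs)"
      and fs: "fmrel (\<lambda>X f. derives A f \<Gamma>1 (fmupd \<gamma> X \<Delta>1)) Xs fs" by (auto elim: derives_TupleE)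
    show ?thesis
    proof (rule cut_right_cases, goal_cases IH normalizable axiom Proj Cotuple)
      case IH
      then show ?case using IHg by blast
    next
      case normalizable
      then show ?thesis .
    next
      case (axiom n)
      then show ?thesis using Z Xs axiom_of_atomic(1)[OF A axiom g(1), of \<gamma>] by auto
    next
      case (Cotuple gs)
      then show ?thesis using g(1) Z Xs by (auto elim: derives_CotupleE)
    next
      case (Proj k g')
      with g(1) Z Xs obtain X where X: "fmlookup Xs k = Some X"
        and g': "derives A g' (fmupd \<gamma> X \<Gamma>2) \<Delta>2"
        by (auto elim: derives_ProjE)
      \<comment> \<open>Dually, the tuple has an entry for the component that the projection
        selects, and (12) applies.\<close>
      from fmrelD[OF fs, of k] X obtain f' where
        f': "fmlookup fs k = Some f'" "derives A f' \<Gamma>1 (fmupd \<gamma> X \<Delta>1)"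
        by (auto simp: option_rel_Some1)
      then show ?thesis
        unfolding left Proj using g' left Proj
        by (intro normalizable_rewrite[OF rewrite.r12] principal) (auto intro: fmran'I)
    qed
  qed
qed

end

section \<open>Elimination of all cuts\<close>

lemma normalizable_Cut:
  assumes A: "polycategory A"
    and "cuttable \<gamma> \<Gamma>1 \<Delta>1 \<Gamma>2 \<Delta>2"
    and "derives A f \<Gamma>1 \<Delta>1" "only_essential_cuts A f"
    and "derives A g \<Gamma>2 \<Delta>2" "only_essential_cuts A g"
  shows "normalizable A (Cut f \<gamma> g) (\<Gamma>1 ++\<^sub>f fmdrop \<gamma> \<Gamma>2) (fmdrop \<gamma> \<Delta>1 ++\<^sub>f \<Delta>2)"
  using assms(2-)
\<comment> \<open>A lexicographic induction: the outer one, on \<open>f\<close>, leaves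
  \<open>g\<close> and all contexts free, while the inner one, on \<open>g\<close>, fixes
  \<open>f\<close> with its sequent.\<close>
proof (induction f arbitrary: g \<Gamma>1 \<Delta>1 \<Gamma>2 \<Delta>2 rule: immediate_induct)
  case (1 f)
  note IHf = "1.IH"
  from "1.prems" show ?case
  proof (induction g arbitrary: \<Gamma>2 \<Delta>2 rule: immediate_induct)
    case (1 g)
    show ?case
      using "1.prems"
    proof (rule cut_step[OF A])
      show "normalizable A (Cut f' \<gamma> g') (\<Gamma>1 ++\<^sub>f fmdrop \<gamma> \<Gamma>2) (fmdrop \<gamma> \<Delta>1 ++\<^sub>f \<Delta>2)"
        if "f' \<in> immediate f" "only_essential_cuts A g'" "cuttable \<gamma> \<Gamma>1 \<Delta>1 \<Gamma>2 \<Delta>2"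
          "derives A f' \<Gamma>1 \<Delta>1" "derives A g' \<Gamma>2 \<Delta>2" for f' g' \<Gamma>1 \<Delta>1 \<Gamma>2 \<Delta>2
        using that IHf only_essential_cuts_immediate[OF "1.prems"(3)] by blast
      show "normalizable A (Cut f \<gamma> g') (\<Gamma>1 ++\<^sub>f fmdrop \<gamma> \<Gamma>2) (fmdrop \<gamma> \<Delta>1 ++\<^sub>f \<Delta>2)"
        if "g' \<in> immediate g" "cuttable \<gamma> \<Gamma>1 \<Delta>1 \<Gamma>2 \<Delta>2" "derives A g' \<Gamma>2 \<Delta>2" for g' \<Gamma>2 \<Delta>2
        using that "1.IH" "1.prems" only_essential_cuts_immediate by blast
    qed
  qed
qed

text \<open>Induction on the derivation realizes the innermost-first strategy: when a cut is
  reached, its premises have already been reduced to derivations with only essential cuts.\<close>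

lemma derives_normalizable:
  assumes A: "polycategory A" and "derives A d \<Gamma> \<Delta>"
  shows "normalizable A d \<Gamma> \<Delta>"
  using assms(2)
proof (induction rule: derives.induct)
  case (Ax f)
  then show ?case
    unfolding normalizable_def by (blast intro: derives.Ax only_essential_cuts.intros)
next
  case (Cotuple \<alpha> \<Gamma> Xs \<Delta> fs)
  then show ?case
    by (intro normalizable_Cotuple[of _ _ Xs]) (auto elim!: fmap.rel_mono_strong)
next
  case (Tuple \<alpha> \<Delta> \<Gamma> Xs fs)
  then show ?case
    by (intro normalizable_Tuple[of _ _ Xs]) (auto elim!: fmap.rel_mono_strong)
next
  case (Proj \<alpha> \<Gamma> Xs \<Delta> k X f)
  then show ?case by (intro normalizable_Proj[of _ _ Xs]) auto
next
  case (Inj \<alpha> \<Delta> \<Gamma> Xs k X f)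
  then show ?case by (intro normalizable_Inj[of _ _ Xs]) auto
next
  case (Cut \<gamma> \<Delta> \<Gamma>' \<Gamma> Z \<Delta>' f g)
  from Cut.IH obtain f' g' where
    f': "(rewrite A)\<^sup>*\<^sup>* f f'" "derives A f' \<Gamma> (fmupd \<gamma> Z \<Delta>)" "only_essential_cuts A f'" and
    g': "(rewrite A)\<^sup>*\<^sup>* g g'" "derives A g' (fmupd \<gamma> Z \<Gamma>') \<Delta>'" "only_essential_cuts A g'"
    by (auto simp: normalizable_def)
  have "(rewrite A)\<^sup>*\<^sup>* (Cut f \<gamma> g) (Cut f' \<gamma> g')" using f'(1) g'(1) by (rule rewrites_Cut)
  moreover have "normalizable A (Cut f' \<gamma> g') (\<Gamma> ++\<^sub>f \<Gamma>') (\<Delta> ++\<^sub>f \<Delta>')"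
    unfolding cuttable_fmupd(2)[OF Cut(1-3)] cuttable_fmupd(3)[OF Cut(1-3)]
    using cuttable_fmupd(1)[OF Cut(1-3)] f'(2,3) g'(2,3) by (rule normalizable_Cut[OF A])
  ultimately show ?case
    unfolding normalizable_def by (meson rtranclp_trans)
qed

theorem proposition2p2p1:
  fixes A :: "('c, 'o, 'm) polycat"
    and d :: "('c, 'n, 'm) deriv"
    and \<Gamma> \<Delta> :: "('c, 'n, 'o) family"
  assumes "polycategory A"
    and "derives A d \<Gamma> \<Delta>"
  shows "\<exists>d'. (rewrite A)\<^sup>*\<^sup>* d d' \<and> derives A d' \<Gamma> \<Delta> \<and> only_essential_cuts A d'"
  using derives_normalizable[OF assms] unfolding normalizable_def .

end
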